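(* Let $G=(V,E)$ be a simple connected graph with $n\geq 2$ vertices $v_1,\dots,v_n$ and $m$ edges, and suppose there is a real $k$ with $\kappa(v,w)\geq k$ for all $\{v,w\}\in E$. Then for every vertex $v_i$ of degree $d_i$, \[\mathcal{LE}_G(v_i)\leq 1-k\left(1-\frac{d_i}{2m}\right).\]
   Context: $A$ is the adjacency matrix, $D$ the diagonal degree matrix, $\mathcal{L}=I-D^{-1/2}AD^{-1/2}$ the normalized Laplacian; for a real symmetric $B$, $|B|:=(B^2)^{1/2}$; $\mathcal{LE}_G(v_i):=(|\mathcal{L}-I|)_{ii}$. For $v\in V$, $m_v$ is the probability measure on $V$ with $m_v(w)=1/d_v$ if $w\sim v$ and $0$ otherwise. $d(x,y)$ is the graph distance. The Wasserstein distance is $W_1(\mu,\nu):=\min_\pi\sum_{(x,y)\in V\times V}d(x,y)\pi(x,y)$, the minimum over probability measures $\pi$ on $V\times V$ with marginals $\mu$ and $\nu$. The Ollivier-Ricci curvature is $\kappa(v,w):=1-\frac{W_1(m_v,m_w)}{d(v,w)}$. *)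

theory Defs
  imports "HOL-Analysis.Analysis" "HOL-Probability.Probability"
begin

text \<open>
  The vertex set is the universe of a finite type and a graph is given by its set of edges.
  Loops and multiple edges are excluded because edges are two-element sets.
\<close>

definition simple_graph :: "'v set set \<Rightarrow> bool" where
  "simple_graph E \<longleftrightarrow> (\<forall>e\<in>E. card e = 2)"

definition adj_rel :: "'v set set \<Rightarrow> ('v \<times> 'v) set" where
  "adj_rel E = {(v, w). {v, w} \<in> E}"

definition connected_graph :: "'v set set \<Rightarrow> bool" where
  "connected_graph E \<longleftrightarrow> (\<forall>v w. (v, w) \<in> (adj_rel E)\<^sup>*)"

definition neighbors :: "'v set set \<Rightarrow> 'v \<Rightarrow> 'v set" where
  "neighbors E v = {w. {v, w} \<in> E}"

definition vertex_degree :: "'v set set \<Rightarrow> 'v \<Rightarrow> nat" where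
  "vertex_degree E v = card (neighbors E v)"

text \<open>
  A walk of length \<open>n\<close> from \<open>v\<close> to \<open>w\<close> is a member of the \<open>n\<close>-fold relational power of adjacency;
  the value is unspecified when there is no walk.
\<close>

definition graph_dist :: "'v set set \<Rightarrow> 'v \<Rightarrow> 'v \<Rightarrow> nat" where
  "graph_dist E v w = (LEAST n. (v, w) \<in> adj_rel E ^^ n)"

definition adjacency_matrix :: "'v::finite set set \<Rightarrow> real ^ 'v ^ 'v" where
  "adjacency_matrix E = (\<chi> v w. if {v, w} \<in> E then 1 else 0)"

text \<open>The matrix \<open>D\<^sup>-\<^sup>1\<^sup>/\<^sup>2\<close>, meaningful when all degrees are positive.\<close>

definition degree_matrix_inv_sqrt :: "'v::finite set set \<Rightarrow> real ^ 'v ^ 'v" where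
  "degree_matrix_inv_sqrt E = (\<chi> v w. if v = w then 1 / sqrt (real (vertex_degree E v)) else 0)"

definition normalized_laplacian :: "'v::finite set set \<Rightarrow> real ^ 'v ^ 'v" where
  "normalized_laplacian E =
     mat 1 - degree_matrix_inv_sqrt E ** adjacency_matrix E ** degree_matrix_inv_sqrt E"

definition pos_semidef :: "real ^ 'n ^ 'n \<Rightarrow> bool" where
  "pos_semidef S \<longleftrightarrow> transpose S = S \<and> (\<forall>x. 0 \<le> x \<bullet> (S *v x))"

text \<open>
  The principal square root \<open>M\<^sup>1\<^sup>/\<^sup>2\<close>: every positive semidefinite \<open>M\<close> has exactly one positive
  semidefinite square root. The value is unspecified for other \<open>M\<close>.
\<close>

definition matrix_sqrt :: "real ^ 'n ^ 'n \<Rightarrow> real ^ 'n ^ 'n" where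
  "matrix_sqrt M = (THE S. pos_semidef S \<and> S ** S = M)"

definition matrix_abs :: "real ^ 'n ^ 'n \<Rightarrow> real ^ 'n ^ 'n" where
  "matrix_abs B = matrix_sqrt (B ** B)"

definition laplacian_vertex_energy :: "'v::finite set set \<Rightarrow> 'v \<Rightarrow> real" where
  "laplacian_vertex_energy E v = matrix_abs (normalized_laplacian E - mat 1) $ v $ v"

definition couplings :: "'v pmf \<Rightarrow> 'v pmf \<Rightarrow> ('v \<times> 'v) pmf set" where
  "couplings \<mu> \<nu> = {\<pi>. map_pmf fst \<pi> = \<mu> \<and> map_pmf snd \<pi> = \<nu>}"

definition transport_cost :: "'v::finite set set \<Rightarrow> ('v \<times> 'v) pmf \<Rightarrow> real" where
  "transport_cost E \<pi> = (\<Sum>(x, y)\<in>UNIV. real (graph_dist E x y) * pmf \<pi> (x, y))"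

text \<open>The infimum is a minimum: see \<open>wasserstein_attained\<close> below.\<close>

definition wasserstein :: "'v::finite set set \<Rightarrow> 'v pmf \<Rightarrow> 'v pmf \<Rightarrow> real" where
  "wasserstein E \<mu> \<nu> = (INF \<pi>\<in>couplings \<mu> \<nu>. transport_cost E \<pi>)"

text \<open>
  The measure \<open>m\<^sub>v\<close> of mass \<open>1 / d\<^sub>v\<close> on every neighbor of \<open>v\<close>. It is unspecified when \<open>v\<close> is isolated.
\<close>

definition neighbor_measure :: "'v::finite set set \<Rightarrow> 'v \<Rightarrow> 'v pmf" where
  "neighbor_measure E v = pmf_of_set (neighbors E v)"

definition ollivier_ricci :: "'v::finite set set \<Rightarrow> 'v \<Rightarrow> 'v \<Rightarrow> real" where
  "ollivier_ricci E v w =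
     1 - wasserstein E (neighbor_measure E v) (neighbor_measure E w) / real (graph_dist E v w)"

lemma pmf_neighbor_measure:
  assumes "neighbors E v \<noteq> {}"
  shows "pmf (neighbor_measure E v) w = (if {v, w} \<in> E then 1 / real (vertex_degree E v) else 0)"
  using assms by (simp add: neighbor_measure_def vertex_degree_def neighbors_def pmf_of_set indicator_def)

lemma pmf_map_fst_finite:
  fixes \<pi> :: "('v::finite \<times> 'v) pmf"
  shows "pmf (map_pmf fst \<pi>) v = (\<Sum>w\<in>UNIV. pmf \<pi> (v, w))"
proof -
  have "pmf (map_pmf fst \<pi>) v = sum (pmf \<pi>) (fst -` {v})"
    by (simp add: pmf_map measure_measure_pmf_finite)
  also have "fst -` {v} = Pair v ` (UNIV :: 'v set)" by auto
  also have "sum (pmf \<pi>) \<dots> = (\<Sum>w\<in>UNIV. pmf \<pi> (v, w))"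
    by (subst sum.reindex) (auto simp: inj_on_def)
  finally show ?thesis .
qed

lemma pmf_map_snd_finite:
  fixes \<pi> :: "('v::finite \<times> 'v) pmf"
  shows "pmf (map_pmf snd \<pi>) w = (\<Sum>v\<in>UNIV. pmf \<pi> (v, w))"
proof -
  have "pmf (map_pmf snd \<pi>) w = sum (pmf \<pi>) (snd -` {w})"
    by (simp add: pmf_map measure_measure_pmf_finite)
  also have "snd -` {w} = (\<lambda>v. (v, w)) ` (UNIV :: 'v set)" by auto
  also have "sum (pmf \<pi>) \<dots> = (\<Sum>v\<in>UNIV. pmf \<pi> (v, w))"
    by (subst sum.reindex) (auto simp: inj_on_def)
  finally show ?thesis .
qed

lemma wasserstein_attained:
  fixes \<mu> \<nu> :: "'v::finite pmf"
  shows "\<exists>\<pi>\<in>couplings \<mu> \<nu>. wasserstein E \<mu> \<nu> = transport_cost E \<pi> \<and>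
           (\<forall>\<rho>\<in>couplings \<mu> \<nu>. transport_cost E \<pi> \<le> transport_cost E \<rho>)"
proof -
  define K :: "(real ^ ('v \<times> 'v)) set" where
    "K = {x. (\<forall>z. 0 \<le> x $ z) \<and> (\<forall>v. (\<Sum>w\<in>UNIV. x $ (v, w)) = pmf \<mu> v)
            \<and> (\<forall>w. (\<Sum>v\<in>UNIV. x $ (v, w)) = pmf \<nu> w)}"
  define c where "c x = (\<Sum>(a, b)\<in>UNIV. real (graph_dist E a b) * x $ (a, b))"
    for x :: "real ^ ('v \<times> 'v)"
  define T :: "('v \<times> 'v) pmf \<Rightarrow> real ^ ('v \<times> 'v)" where "T \<pi> = (\<chi> z. pmf \<pi> z)" for \<pi>
  have T_K: "T \<pi> \<in> K" if "\<pi> \<in> couplings \<mu> \<nu>" for \<pi>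
    using that pmf_map_fst_finite[of \<pi>] pmf_map_snd_finite[of \<pi>]
    by (auto simp: couplings_def K_def T_def)
  have c_T: "c (T \<pi>) = transport_cost E \<pi>" for \<pi>
    by (simp add: c_def T_def transport_cost_def)
  have K_T: "\<exists>\<pi>\<in>couplings \<mu> \<nu>. x = T \<pi>" if x: "x \<in> K" for x
  proof -
    have nn: "0 \<le> x $ z" for z using x unfolding K_def by blast
    have "(\<Sum>z\<in>UNIV. x $ z) = (\<Sum>v\<in>UNIV. \<Sum>w\<in>UNIV. x $ (v, w))"
      by (simp add: sum.cartesian_product flip: UNIV_Times_UNIV)
    also have "\<dots> = (\<Sum>v\<in>UNIV. pmf \<mu> v)" using x by (simp add: K_def)
    also have "\<dots> = 1" by (rule sum_pmf_eq_1) auto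
    finally have s: "(\<Sum>z\<in>UNIV. x $ z) = 1" .
    define \<pi> where "\<pi> = embed_pmf (\<lambda>z. x $ z)"
    have p: "pmf \<pi> z = x $ z" for z
      unfolding \<pi>_def
    proof (rule pmf_embed_pmf)
      show "(\<integral>\<^sup>+z. ennreal (x $ z) \<partial>count_space UNIV) = 1"
        using s nn by (subst nn_integral_count_space_finite) (simp_all only: finite sum_ennreal ennreal_1)
    qed (rule nn)
    have "map_pmf fst \<pi> = \<mu>"
      using x by (intro pmf_eqI) (simp add: pmf_map_fst_finite p K_def)
    moreover have "map_pmf snd \<pi> = \<nu>"
      using x by (intro pmf_eqI) (simp add: pmf_map_snd_finite p K_def)
    ultimately show ?thesis
      by (intro bexI[of _ \<pi>]) (auto simp: couplings_def T_def p vec_eq_iff)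
  qed
  have "pair_pmf \<mu> \<nu> \<in> couplings \<mu> \<nu>"
    by (simp add: couplings_def map_fst_pair_pmf map_snd_pair_pmf)
  then have ne: "K \<noteq> {}" using T_K by blast
  have "K \<subseteq> cbox 0 1"
  proof
    fix x assume "x \<in> K"
    then obtain \<pi> where "x = T \<pi>" using K_T by blast
    then show "x \<in> cbox 0 1"
      by (simp add: T_def mem_box_cart pmf_le_1)
  qed
  then have "bounded K" using bounded_cbox bounded_subset by blast
  moreover have "closed K"
    unfolding K_def
    by (intro closed_Collect_conj closed_Collect_all closed_Collect_le closed_Collect_eq
        continuous_intros)
  ultimately have "compact K" by (simp add: compact_eq_bounded_closed)
  moreover have "continuous_on K c"
    unfolding c_def split_beta by (intro continuous_intros)
  ultimately obtain x where x: "x \<in> K" "\<And>y. y \<in> K \<Longrightarrow> c x \<le> c y"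
    using continuous_attains_inf[of K c] ne by blast
  then obtain \<pi> where \<pi>: "\<pi> \<in> couplings \<mu> \<nu>" "x = T \<pi>" using K_T by blast
  have min: "transport_cost E \<pi> \<le> transport_cost E \<rho>" if "\<rho> \<in> couplings \<mu> \<nu>" for \<rho>
    using x(2)[OF T_K[OF that]] \<pi>(2) by (simp add: c_T)
  then have "wasserstein E \<mu> \<nu> = transport_cost E \<pi>"
    unfolding wasserstein_def using \<pi>(1) by (intro cInf_eq_minimum) auto
  with \<pi>(1) min show ?thesis by blast
qed

end

theory Submission
  imports Defs
begin

text \<open>
  Write \<open>M = \<L> - I\<close>. The unit vector \<open>u\<close> with entries \<open>(d\<^sub>x / 2m)\<^sup>1\<^sup>/\<^sup>2\<close> is an eigenvector of \<open>M\<close>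
  for \<open>-1\<close>; complete it to an orthonormal eigenbasis. If \<open>b \<bottom> u\<close> is an eigenvector for \<open>c\<close>, then
  \<open>g = D\<^sup>-\<^sup>1\<^sup>/\<^sup>2 b\<close> is a nonconstant eigenfunction of the random walk operator for \<open>-c\<close>. At an edge
  \<open>{x, y}\<close> that maximizes \<open>\<bar>g x - g y\<bar> = L\<close>, transporting \<open>m\<^sub>x\<close> to \<open>m\<^sub>y\<close> changes the mean of \<open>g\<close> by at most
  \<open>L W\<^sub>1(m\<^sub>x, m\<^sub>y) \<le> L (1 - k)\<close>, while the means differ by \<open>\<bar>c\<bar> L\<close>; so \<open>\<bar>c\<bar> \<le> 1 - k\<close>. Since
  \<open>\<bar>M\<bar>\<^sub>v\<^sub>v\<close> is the mean of the \<open>\<bar>c\<bar>\<close> with the weights \<open>b\<^sub>v\<^sup>2\<close>, and \<open>u\<close> has weight \<open>d\<^sub>v / 2m\<close>, the bound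
  follows.
\<close>

section \<open>Spectral theorem for self-adjoint maps\<close>

text \<open>The Rayleigh quotient attains its maximum on the compact unit sphere of
  \<open>V\<close>. At a maximizer \<open>x\<close> the residual \<open>c x - f x\<close> vanishes,
  since moving \<open>x\<close> against it would raise the quotient.\<close>

lemma self_adjoint_eigenvector_exists:
  fixes f :: "'a::euclidean_space \<Rightarrow> 'a"
  assumes f: "linear f" and adj: "\<And>x y. f x \<bullet> y = x \<bullet> f y"
    and V: "subspace V" "f ` V \<subseteq> V" "V \<noteq> {0}"
  shows "\<exists>x\<in>V. norm x = 1 \<and> (\<exists>c. f x = c *\<^sub>R x)"
proof -
  interpret f: linear f by (rule f)
  define K where "K = sphere 0 1 \<inter> V"
  have "compact K"
    unfolding K_def by (intro compact_Int_closed compact_sphere closed_subspace V)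
  moreover have "K \<noteq> {}"
  proof -
    obtain z where z: "z \<in> V" "z \<noteq> 0" using V subspace_0 by blast
    then have "(1 / norm z) *\<^sub>R z \<in> K"
      unfolding K_def using V(1) by (auto intro: subspace_scale)
    then show ?thesis by blast
  qed
  moreover have "continuous_on K (\<lambda>x. x \<bullet> f x)"
    by (intro continuous_intros linear_continuous_on f[unfolded linear_conv_bounded_linear])
  ultimately obtain x where x: "x \<in> K" "\<And>y. y \<in> K \<Longrightarrow> y \<bullet> f y \<le> x \<bullet> f x"
    using continuous_attains_sup[of K "\<lambda>x. x \<bullet> f x"] by blast
  define c where "c = x \<bullet> f x"
  have xV: "x \<in> V" and nx: "norm x = 1" using x(1) by (auto simp: K_def)
  have xx: "x \<bullet> x = 1" using nx by (simp add: norm_eq_1)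
  \<comment> \<open>Homogeneity carries the bound to vectors of any length, as
    \<open>x - t *\<^sub>R r\<close> below is not a unit vector.\<close>
  have q: "z \<bullet> f z \<le> c * (z \<bullet> z)" if z: "z \<in> V" for z
  proof (cases "z = 0")
    case False
    let ?u = "(1 / norm z) *\<^sub>R z"
    have "?u \<in> K" unfolding K_def using V(1) z False by (auto intro: subspace_scale)
    then have "?u \<bullet> f ?u \<le> c" unfolding c_def by (rule x(2))
    then have "(z \<bullet> f z) / (norm z)\<^sup>2 \<le> c"
      by (simp add: f.scaleR power2_eq_square)
    then show ?thesis using False by (simp add: divide_simps power2_norm_eq_inner)
  qed (simp add: f.zero)
  define r where "r = c *\<^sub>R x - f x"
  have rV: "r \<in> V" unfolding r_def using V xV by (auto intro!: subspace_diff subspace_scale)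
  have rx: "r \<bullet> x = 0" by (simp add: r_def inner_diff_left xx c_def adj)
  \<comment> \<open>First variation of the Rayleigh quotient in the direction of the residual.\<close>
  have var: "2 * t * (r \<bullet> r) \<le> t\<^sup>2 * (c * (r \<bullet> r) - r \<bullet> f r)" for t
  proof -
    have "(x - t *\<^sub>R r) \<in> V" using V xV rV by (auto intro!: subspace_diff subspace_scale)
    from q[OF this] have "(x - t *\<^sub>R r) \<bullet> f (x - t *\<^sub>R r) \<le> c * ((x - t *\<^sub>R r) \<bullet> (x - t *\<^sub>R r))" .
    moreover have "x \<bullet> f r = - (r \<bullet> r)" "r \<bullet> f x = - (r \<bullet> r)"
      using rx adj[of x r] by (auto simp: r_def inner_diff_right inner_diff_left inner_commute)
    ultimately show ?thesis
      using rx xx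
      by (simp add: f.diff f.scaleR inner_diff_left inner_diff_right inner_commute[of x r] algebra_simps
          power2_eq_square flip: c_def)
  qed
  have "r \<bullet> r = 0"
  proof (rule ccontr)
    assume "r \<bullet> r \<noteq> 0"
    then have p: "r \<bullet> r > 0" by (simp add: inner_gt_zero_iff)
    define A where "A = c * (r \<bullet> r) - r \<bullet> f r"
    \<comment> \<open>Chosen so that \<open>t * A\<close> is at most \<open>r \<bullet> r\<close>;
      then \<open>var\<close> bounds \<open>2 * t * (r \<bullet> r)\<close> by half of itself. The
      \<open>+ 1\<close> keeps the denominator positive.\<close>
    define t where "t = (r \<bullet> r) / (\<bar>A\<bar> + 1)"
    have t: "t > 0" using p by (simp add: t_def)
    have "t * A \<le> t * (\<bar>A\<bar> + 1)" using t by (intro mult_left_mono) auto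
    also have "\<dots> = r \<bullet> r" by (simp add: t_def)
    finally have "t * (t * A) \<le> t * (r \<bullet> r)" using t by (intro mult_left_mono) auto
    then have "2 * t * (r \<bullet> r) \<le> t * (r \<bullet> r)"
      using var[of t] by (simp add: A_def power2_eq_square mult.assoc)
    with mult_pos_pos[OF t p] show False by simp
  qed
  then have "f x = c *\<^sub>R x" by (simp add: r_def)
  with xV nx show ?thesis by blast
qed

lemma orthonormal_insert_span:
  fixes x :: "'a::euclidean_space"
  assumes V: "subspace V" and x: "x \<in> V" "norm x = 1"
    and B: "span B = {y \<in> V. orthogonal x y}"
  shows "span (insert x B) = V"
proof
  have "B \<subseteq> V" using span_superset[of B] B by blast
  then show "span (insert x B) \<subseteq> V" using x V by (intro span_minimal) auto
  show "V \<subseteq> span (insert x B)"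
  proof
    fix y assume y: "y \<in> V"
    have "y - (x \<bullet> y) *\<^sub>R x \<in> span B"
      unfolding B using x V y
      by (auto simp: orthogonal_def inner_diff_right norm_eq_1 intro!: subspace_diff subspace_scale)
    then show "y \<in> span (insert x B)" by (auto simp: span_insert)
  qed
qed

text \<open>Induction on dimension: by self-adjointness, the orthogonal complement in
  \<open>V\<close> of an eigenvector is again invariant. Invariant subspaces also serve the later
  use on the complement of a known eigenvector.\<close>

lemma self_adjoint_orthonormal_eigenbasis:
  fixes f :: "'a::euclidean_space \<Rightarrow> 'a"
  assumes f: "linear f" and adj: "\<And>x y. f x \<bullet> y = x \<bullet> f y"
    and "subspace V" "f ` V \<subseteq> V"
  shows "\<exists>B. finite B \<and> pairwise orthogonal B \<and> (\<forall>b\<in>B. norm b = 1) \<and> span B = V \<and>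
           (\<forall>b\<in>B. \<exists>c. f b = c *\<^sub>R b)"
  using assms(3,4)
proof (induction "dim V" arbitrary: V rule: less_induct)
  case less
  show ?case
  proof (cases "V = {0}")
    case True
    then show ?thesis by (intro exI[of _ "{}"]) auto
  next
    case False
    then obtain x c where x: "x \<in> V" "norm x = 1" "f x = c *\<^sub>R x"
      using self_adjoint_eigenvector_exists[OF f adj less.prems] by blast
    define W where "W = {y \<in> V. orthogonal x y}"
    have W: "subspace W"
      using less.prems(1)
      by (auto simp: W_def subspace_def orthogonal_def inner_add_right)
    have "x \<notin> W" using x by (auto simp: W_def orthogonal_def)
    then have "W \<subset> V" using x by (auto simp: W_def)
    then have "dim W < dim V"
      using W less.prems(1) by (metis dim_psubset span_eq_iff)
    moreover have "f ` W \<subseteq> W"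
      using less.prems(2) adj[of x] x(3) by (auto simp: W_def orthogonal_def simp flip: adj)
    ultimately obtain B where B: "finite B" "pairwise orthogonal B" "\<forall>b\<in>B. norm b = 1"
        "span B = W" "\<forall>b\<in>B. \<exists>c. f b = c *\<^sub>R b"
      using less.hyps[OF _ W] by blast
    have "\<forall>b\<in>B. orthogonal x b" using span_superset[of B] B(4) by (auto simp: W_def)
    with B x have "pairwise orthogonal (insert x B)"
      by (auto simp: pairwise_insert orthogonal_commute)
    moreover have "span (insert x B) = V"
      using orthonormal_insert_span[OF less.prems(1) x(1,2)] B(4) by (simp add: W_def)
    ultimately show ?thesis using B x by (intro exI[of _ "insert x B"]) auto
  qed
qed

section \<open>Absolute value of a matrix from an eigenbasis\<close>

lemma matrix_eq_on_span:
  fixes S T :: "real ^ 'n ^ 'n"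
  assumes "span B = UNIV" "\<And>b. b \<in> B \<Longrightarrow> S *v b = T *v b"
  shows "S = T"
proof -
  have "S *v x = T *v x" for x
    using assms linear_eq_on_span[of "(*v) S" "(*v) T" B x] by auto
  then show ?thesis by (simp add: matrix_eq)
qed

text \<open>The source of uniqueness of the square root: the action of \<open>S\<close> on
  eigenvectors of its square is forced.\<close>

lemma pos_semidef_eigenvector_of_square:
  fixes S :: "real ^ 'n ^ 'n"
  assumes S: "pos_semidef S" and c: "c \<ge> 0" and b: "(S ** S) *v b = c\<^sup>2 *\<^sub>R b"
  shows "S *v b = c *\<^sub>R b"
proof -
  have SS: "S *v (S *v b) = c\<^sup>2 *\<^sub>R b" using b by (simp add: matrix_vector_mul_assoc)
  have sym: "transpose S = S" using S by (simp add: pos_semidef_def)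
  define y where "y = S *v b - c *\<^sub>R b"
  \<comment> \<open>\<open>(S + c) (S - c) b = 0\<close>, so \<open>y\<close> is a null vector or an eigenvector for \<open>- c \<le> 0\<close>.\<close>
  have Sy: "S *v y = - c *\<^sub>R y"
    by (simp add: y_def matrix_vector_mult_diff_distrib matrix_vector_mult_scaleR SS algebra_simps
        power2_eq_square)
  have "0 \<le> y \<bullet> (S *v y)" using S by (simp add: pos_semidef_def)
  then have le: "c * (y \<bullet> y) \<le> 0" by (simp add: Sy)
  show ?thesis
  proof (cases "c = 0")
    case False
    then have "y \<bullet> y \<le> 0" using le c by (simp add: mult_le_0_iff)
    then have "y = 0" by (metis inner_ge_zero inner_eq_zero_iff order_antisym)
    then show ?thesis by (simp add: y_def)
  next
    case True
    \<comment> \<open>For \<open>c = 0\<close> the inequality is void; symmetry gives that the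
      squared norm of \<open>S *v b\<close> is
      \<open>b \<bullet> (S *v (S *v b)) = 0\<close>.\<close>
    have "(S *v b) \<bullet> (S *v b) = b \<bullet> (S *v (S *v b))"
      using sym by (metis dot_lmul_matrix vector_transpose_matrix)
    then show ?thesis using SS True by simp
  qed
qed

lemma matrix_abs_eq_eigenbasis:
  fixes M :: "real ^ 'n ^ 'n"
  assumes B: "finite B" "pairwise orthogonal B" "\<forall>b\<in>B. norm b = 1" "span B = UNIV"
    and M: "\<And>b. b \<in> B \<Longrightarrow> M *v b = c b *\<^sub>R b"
  shows "matrix_abs M = (\<chi> i j. \<Sum>b\<in>B. \<bar>c b\<bar> * b $ i * b $ j)" (is "_ = ?S")
proof -
  have S: "?S *v x = (\<Sum>b\<in>B. (\<bar>c b\<bar> * (b \<bullet> x)) *\<^sub>R b)" for x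
  proof -
    have "(?S *v x) $ i = (\<Sum>b\<in>B. (\<bar>c b\<bar> * (b \<bullet> x)) *\<^sub>R b) $ i" for i
      by (simp add: matrix_vector_mult_def inner_vec_def sum_distrib_left sum_distrib_right
          sum.swap[of _ B] mult_ac)
    then show ?thesis by (simp add: vec_eq_iff)
  qed
  have Sb: "?S *v b = \<bar>c b\<bar> *\<^sub>R b" if b: "b \<in> B" for b
  proof -
    have "a \<bullet> b = (if a = b then 1 else 0)" if "a \<in> B" for a
      using that b B(2,3) by (auto simp: pairwise_def orthogonal_def norm_eq_1)
    then show ?thesis unfolding S using b B(1)
      by (subst sum.mono_neutral_right[of B "{b}"]) auto
  qed
  have M2: "(M ** M) *v b = \<bar>c b\<bar>\<^sup>2 *\<^sub>R b" if "b \<in> B" for b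
    using M[OF that]
    by (simp add: matrix_vector_mult_scaleR power2_eq_square flip: matrix_vector_mul_assoc)
  have "pos_semidef ?S"
    unfolding pos_semidef_def S
    by (auto simp: transpose_def vec_eq_iff mult_ac inner_sum_right inner_commute intro!: sum_nonneg)
  moreover have "?S ** ?S = M ** M"
    by (rule matrix_eq_on_span[OF B(4)])
      (simp only: M2,
        simp add: Sb matrix_vector_mult_scaleR power2_eq_square flip: matrix_vector_mul_assoc)
  \<comment> \<open>\<open>matrix_sqrt\<close> is a definite description, so any competing root must
    agree with \<open>?S\<close> on the basis.\<close>
  moreover have "T = ?S" if "pos_semidef T" "T ** T = M ** M" for T
  proof (rule matrix_eq_on_span[OF B(4)])
    fix b assume b: "b \<in> B"
    have "T *v b = \<bar>c b\<bar> *\<^sub>R b"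
      by (rule pos_semidef_eigenvector_of_square[OF that(1)]) (simp_all only: that(2) M2[OF b] abs_ge_zero)
    then show "T *v b = ?S *v b" by (simp only: Sb[OF b])
  qed
  ultimately show ?thesis
    unfolding matrix_abs_def matrix_sqrt_def by (blast intro: the_equality)
qed

text \<open>Expand the coordinate vector \<open>axis i 1\<close> in the basis and read off its own
  coordinate.\<close>

lemma sum_squares_orthonormal_basis:
  fixes B :: "(real ^ 'n) set"
  assumes "finite B" "pairwise orthogonal B" "\<forall>b\<in>B. norm b = 1" "span B = UNIV"
  shows "(\<Sum>b\<in>B. (b $ i)\<^sup>2) = 1"
proof -
  have "(\<Sum>b\<in>B. (axis i 1 \<bullet> b) *\<^sub>R b) = axis i 1"
    using assms by (intro orthonormal_basis_expand) auto
  then have "(\<Sum>b\<in>B. (axis i 1 \<bullet> b) *\<^sub>R b) $ i = 1" by simp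
  then show ?thesis by (simp add: inner_axis' power2_eq_square)
qed

section \<open>Degrees, connectivity and graph distance\<close>

lemma sum_vertex_degree:
  fixes E :: "'v::finite set set"
  assumes "simple_graph E"
  shows "(\<Sum>v\<in>UNIV. vertex_degree E v) = 2 * card E"
proof -
  have "vertex_degree E v = card {e \<in> E. v \<in> e}" for v
    unfolding vertex_degree_def
  proof (rule bij_betw_same_card)
    show "bij_betw (\<lambda>w. {v, w}) (neighbors E v) {e \<in> E. v \<in> e}"
      unfolding bij_betw_def
    proof
      show "inj_on (\<lambda>w. {v, w}) (neighbors E v)"
        by (auto simp: inj_on_def doubleton_eq_iff)
      show "(\<lambda>w. {v, w}) ` neighbors E v = {e \<in> E. v \<in> e}"
      proof (intro equalityI subsetI)
        fix e assume e: "e \<in> {e \<in> E. v \<in> e}"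
        then have "card e = 2" using assms by (simp add: simple_graph_def)
        then obtain w where "e = {v, w}" using e by (auto simp: card_2_iff)
        with e show "e \<in> (\<lambda>w. {v, w}) ` neighbors E v" by (auto simp: neighbors_def)
      qed (auto simp: neighbors_def)
    qed
  qed
  then have "(\<Sum>v\<in>UNIV. vertex_degree E v) = (\<Sum>v\<in>UNIV. card {e \<in> E. v \<in> e})" by simp
  also have "\<dots> = 2 * card E"
    using assms by (intro sum_multicount) (auto simp: simple_graph_def)
  finally show ?thesis .
qed

text \<open>The first edge of a walk to another vertex supplies a neighbor. This makes
  \<open>neighbor_measure\<close> specified and all degrees positive.\<close>

lemma connected_graph_neighbors_nonempty:
  fixes E :: "'v::finite set set"
  assumes "connected_graph E" "CARD('v) \<ge> 2"
  shows "neighbors E v \<noteq> {}"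
proof -
  have "UNIV \<noteq> {v}"
  proof
    assume "UNIV = {v}"
    then have "CARD('v) = card {v}" by (rule arg_cong)
    then show False using assms(2) by simp
  qed
  then obtain w where "w \<noteq> v" by blast
  moreover have "(v, w) \<in> (adj_rel E)\<^sup>*" using assms(1) by (simp add: connected_graph_def)
  ultimately obtain z where "(v, z) \<in> adj_rel E" by (metis converse_rtranclE)
  then show ?thesis by (auto simp: adj_rel_def neighbors_def)
qed

lemma connected_graph_constant:
  assumes "connected_graph E" "\<And>x y. {x, y} \<in> E \<Longrightarrow> g x = g y"
  shows "g x = g y"
proof -
  have "(x, y) \<in> (adj_rel E)\<^sup>*" using assms(1) by (simp add: connected_graph_def)
  then show ?thesis by induction (use assms(2) in \<open>auto simp: adj_rel_def\<close>)
qed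

lemma abs_diff_le_graph_dist:
  fixes g :: "'v \<Rightarrow> real"
  assumes conn: "connected_graph E" and L: "\<And>x y. {x, y} \<in> E \<Longrightarrow> \<bar>g x - g y\<bar> \<le> L"
  shows "\<bar>g x - g y\<bar> \<le> L * real (graph_dist E x y)"
proof -
  have walk: "\<bar>g x - g y\<bar> \<le> L * real n" if "(x, y) \<in> adj_rel E ^^ n" for n y
    using that
  proof (induction n arbitrary: y)
    case (Suc n)
    then obtain z where z: "(x, z) \<in> adj_rel E ^^ n" "{z, y} \<in> E" by (auto simp: adj_rel_def)
    show ?case using Suc.IH[OF z(1)] L[OF z(2)] by (simp add: algebra_simps)
  qed simp
  have "(x, y) \<in> (adj_rel E)\<^sup>*" using conn by (simp add: connected_graph_def)
  then obtain n where "(x, y) \<in> adj_rel E ^^ n" by (auto simp: rtrancl_power)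
  \<comment> \<open>Connectivity provides some walk, so the \<open>LEAST\<close> in
    \<open>graph_dist\<close> is attained.\<close>
  then have "(x, y) \<in> adj_rel E ^^ graph_dist E x y" unfolding graph_dist_def by (rule LeastI)
  then show ?thesis by (rule walk)
qed

lemma graph_dist_edge:
  assumes "simple_graph E" "{x, y} \<in> E"
  shows "graph_dist E x y = 1"
  unfolding graph_dist_def
proof (rule Least_equality)
  show "(x, y) \<in> adj_rel E ^^ 1" using assms(2) by (simp add: adj_rel_def)
  have "x \<noteq> y" using assms by (auto simp: simple_graph_def)
  then show "1 \<le> n" if "(x, y) \<in> adj_rel E ^^ n" for n using that by (cases n) auto
qed

section \<open>Optimal transport and the curvature bound on eigenvalues\<close>

text \<open>The easy half of Kantorovich duality.\<close>

lemma lipschitz_expectation_diff_le_wasserstein: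
  fixes E :: "'v::finite set set" and g :: "'v \<Rightarrow> real"
  assumes "\<And>x y. \<bar>g x - g y\<bar> \<le> L * real (graph_dist E x y)"
  shows "\<bar>(\<Sum>x\<in>UNIV. pmf \<mu> x * g x) - (\<Sum>x\<in>UNIV. pmf \<nu> x * g x)\<bar> \<le> L * wasserstein E \<mu> \<nu>"
proof -
  obtain \<pi> where \<pi>: "\<pi> \<in> couplings \<mu> \<nu>" "wasserstein E \<mu> \<nu> = transport_cost E \<pi>"
    using wasserstein_attained by blast
  have "map_pmf fst \<pi> = \<mu>" "map_pmf snd \<pi> = \<nu>" using \<pi>(1) by (auto simp: couplings_def)
  then have \<mu>: "pmf \<mu> x = (\<Sum>y\<in>UNIV. pmf \<pi> (x, y))"
    and \<nu>: "pmf \<nu> y = (\<Sum>x\<in>UNIV. pmf \<pi> (x, y))" for x y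
    using pmf_map_fst_finite[of \<pi>] pmf_map_snd_finite[of \<pi>] by metis+
  \<comment> \<open>Writing both means against the same coupling turns their difference into the
    mean of \<open>g x - g y\<close>.\<close>
  have 1: "(\<Sum>x\<in>UNIV. pmf \<mu> x * g x) = (\<Sum>x\<in>UNIV. \<Sum>y\<in>UNIV. pmf \<pi> (x, y) * g x)"
    by (simp add: \<mu> sum_distrib_right)
  have 2: "(\<Sum>x\<in>UNIV. pmf \<nu> x * g x) = (\<Sum>x\<in>UNIV. \<Sum>y\<in>UNIV. pmf \<pi> (x, y) * g y)"
    by (subst sum.swap) (simp add: \<nu> sum_distrib_right)
  have "\<bar>(\<Sum>x\<in>UNIV. pmf \<mu> x * g x) - (\<Sum>x\<in>UNIV. pmf \<nu> x * g x)\<bar>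
      = \<bar>\<Sum>x\<in>UNIV. \<Sum>y\<in>UNIV. pmf \<pi> (x, y) * (g x - g y)\<bar>"
    unfolding 1 2 by (simp add: right_diff_distrib sum_subtractf)
  also have "\<dots> \<le> (\<Sum>x\<in>UNIV. \<Sum>y\<in>UNIV. pmf \<pi> (x, y) * (L * real (graph_dist E x y)))"
    by (intro order_trans[OF sum_abs] sum_mono) (simp add: abs_mult assms mult_left_mono)
  also have "\<dots> = L * transport_cost E \<pi>"
    by (simp add: transport_cost_def sum_distrib_left sum.cartesian_product mult_ac
        case_prod_unfold flip: UNIV_Times_UNIV)
  finally show ?thesis by (simp add: \<pi>(2))
qed

lemma random_walk_eigenvalue_le:
  fixes E :: "'v::finite set set" and g :: "'v \<Rightarrow> real"
  assumes G: "simple_graph E" "connected_graph E"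
    and curv: "\<forall>x y. {x, y} \<in> E \<longrightarrow> ollivier_ricci E x y \<ge> k"
    and eig: "\<And>x. (\<Sum>y\<in>UNIV. pmf (neighbor_measure E x) y * g y) = c * g x"
    and nonconst: "g a \<noteq> g b"
  shows "\<bar>c\<bar> \<le> 1 - k"
proof -
  define R where "R = (\<lambda>(x, y). \<bar>g x - g y\<bar>) ` adj_rel E"
  have ne: "\<exists>x y. {x, y} \<in> E \<and> g x \<noteq> g y"
    using connected_graph_constant[OF G(2), of g a b] nonconst by blast
  then have R: "finite R" "R \<noteq> {}" by (auto simp: R_def adj_rel_def)
  define L where "L = Max R"
  have le: "\<bar>g x - g y\<bar> \<le> L" if "{x, y} \<in> E" for x y
    unfolding L_def by (rule Max_ge[OF R(1)]) (use that in \<open>force simp: R_def adj_rel_def\<close>)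
  have "L \<in> R" unfolding L_def using R by (rule Max_in)
  then obtain x y where xy: "{x, y} \<in> E" "\<bar>g x - g y\<bar> = L" by (auto simp: R_def adj_rel_def)
  obtain u v where "{u, v} \<in> E" "g u \<noteq> g v" using ne by blast
  then have "L > 0" using le[of u v] by linarith
  \<comment> \<open>The endpoints are at distance 1, so the quotient in
    \<open>ollivier_ricci\<close> is the Wasserstein distance itself.\<close>
  have W: "wasserstein E (neighbor_measure E x) (neighbor_measure E y) \<le> 1 - k"
    using curv[rule_format, OF xy(1)] graph_dist_edge[OF G(1) xy(1)]
    by (simp add: ollivier_ricci_def)
  have "\<bar>c\<bar> * L = \<bar>c * g x - c * g y\<bar>"
    by (simp add: abs_mult flip: right_diff_distrib xy(2))
  also have "\<dots> \<le> L * wasserstein E (neighbor_measure E x) (neighbor_measure E y)"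
    unfolding eig[symmetric]
    by (intro lipschitz_expectation_diff_le_wasserstein abs_diff_le_graph_dist G le)
  also have "\<dots> \<le> L * (1 - k)" using W \<open>L > 0\<close> by (intro mult_left_mono) auto
  finally show ?thesis using \<open>L > 0\<close> by (simp add: mult.commute)
qed

section \<open>The normalized Laplacian and the energy bound\<close>

lemma normalized_laplacian_minus_id:
  "(normalized_laplacian E - mat 1) $ x $ y
     = - (if {x, y} \<in> E
          then 1 / (sqrt (real (vertex_degree E x)) * sqrt (real (vertex_degree E y))) else 0)"
proof -
  have "(degree_matrix_inv_sqrt E ** adjacency_matrix E) $ x $ z
      = (if {x, z} \<in> E then 1 / sqrt (real (vertex_degree E x)) else 0)" for z
    by (simp add: matrix_matrix_mult_def degree_matrix_inv_sqrt_def adjacency_matrix_def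
        if_distrib[of "\<lambda>t. t * _"] cong: if_cong)
  then have "(degree_matrix_inv_sqrt E ** adjacency_matrix E ** degree_matrix_inv_sqrt E) $ x $ y
      = (if {x, y} \<in> E
          then 1 / (sqrt (real (vertex_degree E x)) * sqrt (real (vertex_degree E y))) else 0)"
    unfolding matrix_matrix_mult_def[of _ "degree_matrix_inv_sqrt E"]
    by (simp add: degree_matrix_inv_sqrt_def if_distrib[of "\<lambda>t. _ * t"] cong: if_cong)
  then show ?thesis by (simp add: normalized_laplacian_def)
qed

theorem theorem4p12:
  fixes E :: "'v::finite set set" and k :: real and v :: 'v
  assumes "simple_graph E"
    and "connected_graph E"
    and "CARD('v) \<ge> 2"
    and "\<forall>x y. {x, y} \<in> E \<longrightarrow> ollivier_ricci E x y \<ge> k"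
  shows "laplacian_vertex_energy E v
           \<le> 1 - k * (1 - real (vertex_degree E v) / (2 * real (card E)))"
proof -
  define d where "d x = real (vertex_degree E x)" for x
  define M where "M = normalized_laplacian E - mat 1"
  have ne: "neighbors E x \<noteq> {}" for x
    by (rule connected_graph_neighbors_nonempty[OF assms(2,3)])
  then have d: "d x > 0" for x by (simp add: d_def vertex_degree_def card_gt_0_iff)
  have M: "M $ x $ y = - (if {x, y} \<in> E then 1 / (sqrt (d x) * sqrt (d y)) else 0)" for x y
    unfolding M_def d_def by (rule normalized_laplacian_minus_id)
  have "transpose M = M" by (simp add: vec_eq_iff transpose_def M insert_commute mult.commute)
  then have adj: "(M *v x) \<bullet> y = x \<bullet> (M *v y)" for x y
    by (metis dot_lmul_matrix transpose_matrix_vector)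
  \<comment> \<open>Scaling by \<open>1 / sqrt (d x)\<close> conjugates \<open>- M\<close> into the
    random walk operator, which translates eigenvectors of \<open>M\<close> into eigenfunctions of
    the walk with the sign reversed.\<close>
  have mean: "(\<Sum>y\<in>UNIV. pmf (neighbor_measure E x) y * (z $ y / sqrt (d y)))
      = - (M *v z) $ x / sqrt (d x)" for z x
  proof -
    have "pmf (neighbor_measure E x) y * (z $ y / sqrt (d y)) = - (M $ x $ y * z $ y) / sqrt (d x)"
      for y
    proof -
      have "sqrt (d x) * sqrt (d x) = d x" using d[of x] by simp
      moreover have "pmf (neighbor_measure E x) y = (if {x, y} \<in> E then 1 / d x else 0)"
        unfolding d_def by (rule pmf_neighbor_measure[OF ne])
      ultimately show ?thesis by (simp add: M mult.commute mult.left_commute)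
    qed
    then show ?thesis by (simp add: matrix_vector_mult_def sum_divide_distrib flip: sum_negf)
  qed
  \<comment> \<open>Here \<open>m\<close> is the sum of the degrees, twice the number of
    edges.\<close>
  define m where "m = 2 * real (card E)"
  have sum_d: "(\<Sum>x\<in>UNIV. d x) = m"
    using arg_cong[OF sum_vertex_degree[OF assms(1)], of real] by (simp add: d_def m_def)
  have "m > 0" unfolding sum_d[symmetric] using d by (intro sum_pos) auto
  define u :: "real ^ 'v" where "u = (\<chi> x. sqrt (d x / m))"
  \<comment> \<open>Dividing \<open>u\<close> by \<open>sqrt (d x)\<close> gives the constant
    \<open>1 / sqrt m\<close>, which averaging fixes.\<close>
  have Mu: "M *v u = - 1 *\<^sub>R u"
  proof -
    have "(M *v u) $ x = - u $ x" for x
    proof -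
      have "(\<Sum>y\<in>UNIV. pmf (neighbor_measure E x) y * (u $ y / sqrt (d y)))
          = (\<Sum>y\<in>UNIV. pmf (neighbor_measure E x) y) * (1 / sqrt m)"
        unfolding sum_distrib_right
        using d by (intro sum.cong) (auto simp: u_def real_sqrt_divide less_imp_neq[symmetric])
      also have "(\<Sum>y\<in>UNIV. pmf (neighbor_measure E x) y) = 1" by (rule sum_pmf_eq_1) auto
      finally have "- (M *v u) $ x / sqrt (d x) = 1 / sqrt m" unfolding mean by simp
      then have "(M *v u) $ x = - (sqrt (d x) / sqrt m)" using d[of x] by (simp add: field_simps)
      then show ?thesis by (simp add: u_def real_sqrt_divide)
    qed
    then show ?thesis by (simp add: vec_eq_iff)
  qed
  have nu: "norm u = 1"
    using d \<open>m > 0\<close> sum_d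
    by (simp add: norm_eq_1 inner_vec_def u_def less_imp_le flip: sum_divide_distrib)
  \<comment> \<open>Diagonalizing on the complement of \<open>u\<close> ensures that
    \<open>u\<close> itself belongs to the final basis, so its contribution can be split off
    exactly.\<close>
  define W where "W = {y \<in> UNIV. orthogonal u y}"
  have "subspace W" by (simp add: W_def subspace_orthogonal_to_vector)
  moreover have "(*v) M ` W \<subseteq> W"
    by (auto simp: W_def orthogonal_def Mu simp flip: adj)
  ultimately obtain B where B: "finite B" "pairwise orthogonal B" "\<forall>b\<in>B. norm b = 1" "span B = W"
      and eigB: "\<forall>b\<in>B. \<exists>c. M *v b = c *\<^sub>R b"
    using self_adjoint_orthonormal_eigenbasis[of "(*v) M" W] adj by auto
  define C where "C = insert u B"
  have BW: "orthogonal u b" if "b \<in> B" for b using that span_superset[of B] B(4) by (auto simp: W_def)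
  have uB: "u \<notin> B" using BW[of u] nu by (auto simp: orthogonal_def)
  have C: "finite C" "pairwise orthogonal C" "\<forall>b\<in>C. norm b = 1" "span C = UNIV"
    using B BW nu orthonormal_insert_span[of UNIV u B]
    by (auto simp: C_def pairwise_insert orthogonal_commute W_def)
  have "\<forall>b\<in>C. \<exists>c. M *v b = c *\<^sub>R b" using eigB Mu unfolding C_def by blast
  then obtain c where c: "\<And>b. b \<in> C \<Longrightarrow> M *v b = c b *\<^sub>R b" by metis
  have "c u *\<^sub>R u = - 1 *\<^sub>R u" using c[of u] Mu by (simp add: C_def)
  then have cu: "c u = - 1" using nu by (metis norm_zero scaleR_cancel_right zero_neq_one)
  have cb: "\<bar>c b\<bar> \<le> 1 - k" if b: "b \<in> B" for b
  proof -
    define g where "g x = b $ x / sqrt (d x)" for x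
    have bg: "b $ x = g x * sqrt (d x)" for x using d[of x] by (simp add: g_def)
    \<comment> \<open>A constant \<open>g = t\<close> would mean that \<open>b\<close> is
      \<open>t * sqrt m\<close> times \<open>u\<close>; orthogonality to \<open>u\<close> then
      forces \<open>t = 0\<close>, against \<open>norm b = 1\<close>.\<close>
    have "\<exists>x y. g x \<noteq> g y"
    proof (rule ccontr)
      assume "\<not> ?thesis"
      then obtain t where t: "\<And>x. g x = t" by metis
      have "u $ x * b $ x = d x * (t / sqrt m)" for x
        using d[of x]
        by (simp add: u_def bg t real_sqrt_divide mult.left_commute[of _ t] mult.commute[of _ t])
      then have "u \<bullet> b = (\<Sum>x\<in>UNIV. d x * (t / sqrt m))" by (simp add: inner_vec_def)
      also have "\<dots> = m * (t / sqrt m)" by (simp only: sum_distrib_right[symmetric] sum_d)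
      finally have "t = 0" using BW[OF b] \<open>m > 0\<close> by (simp add: orthogonal_def)
      then have "b = 0" by (simp add: vec_eq_iff bg t)
      then show False using B(3) b by auto
    qed
    then obtain x y where "g x \<noteq> g y" by blast
    then have "\<bar>- c b\<bar> \<le> 1 - k"
      using mean[of _ b] c[of b] b
      by (intro random_walk_eigenvalue_le[OF assms(1,2,4), of g]) (simp_all add: g_def C_def)
    then show ?thesis by simp
  qed
  have u2: "(u $ v)\<^sup>2 = d v / m" using d[of v] \<open>m > 0\<close> by (simp add: u_def)
  \<comment> \<open>The squared entries at \<open>v\<close> over the whole basis sum to 1; the share
    of \<open>u\<close> is \<open>d v / m\<close>.\<close>
  have B2: "(\<Sum>b\<in>B. (b $ v)\<^sup>2) = 1 - d v / m"
    using sum_squares_orthonormal_basis[OF C, of v] B(1) uB by (simp add: C_def u2)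
  have "laplacian_vertex_energy E v = (\<Sum>b\<in>C. \<bar>c b\<bar> * (b $ v)\<^sup>2)"
    unfolding laplacian_vertex_energy_def M_def[symmetric]
    by (simp add: matrix_abs_eq_eigenbasis[OF C c] power2_eq_square mult.assoc)
  also have "\<dots> = d v / m + (\<Sum>b\<in>B. \<bar>c b\<bar> * (b $ v)\<^sup>2)"
    using B(1) uB by (simp add: C_def cu u2)
  \<comment> \<open>Only the vectors orthogonal to \<open>u\<close> are estimated; \<open>u\<close>
    keeps its exact factor 1.\<close>
  also have "\<dots> \<le> d v / m + (\<Sum>b\<in>B. (1 - k) * (b $ v)\<^sup>2)"
    by (intro add_left_mono sum_mono mult_right_mono cb) auto
  also have "\<dots> = 1 - k * (1 - d v / m)"
    unfolding sum_distrib_left[symmetric] B2 by (simp add: algebra_simps diff_divide_distrib)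
  finally show ?thesis by (simp add: d_def m_def)
qed

end
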